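(* Let $\mathbb{P}$ be a probability distribution supported on a finite set $\Xi \subseteq \{0,1\}^M$, let $\hat{\bm{\xi}}^{(1)},\ldots,\hat{\bm{\xi}}^{(N)}$ be independent and identically distributed observations from $\mathbb{P}$, and let $\hat{\mathbb{P}}_N = \frac1N\sum_{i=1}^N \delta_{\hat{\bm{\xi}}^{(i)}}$ be the empirical distribution. For every fixed sample size $N > 0$ and confidence level $\beta \in (0,1)$, the guarantee $$\mathbb{P}^N\left[d_W(\mathbb{P}, \hat{\mathbb{P}}_N) \leq \varepsilon_N(\beta)\right] \geq 1-\beta$$ holds whenever $$\varepsilon_N(\beta) \geq D\sqrt{(2N)^{-1}\left(|\Xi|\log(N+1) + \log \beta^{-1}\right)},$$ where $D := \max_{\bm{\xi},\bm{\xi}'\in\Xi} d(\bm{\xi},\bm{\xi}')$ is the diameter of $\Xi$ with respect to the metric $d$.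
   Context: $d(\bm{\xi},\bm{\xi}')=\|\bm{\xi}-\bm{\xi}'\|$ is a metric on $\Xi$ induced by an arbitrary norm $\|\cdot\|$ on $\mathbb{R}^M$. $\mathcal{M}(S)$ denotes the set of all probability distributions supported on $S$. The Wasserstein distance between two distributions $\mathbb{P},\mathbb{P}'$ in $\mathcal{M}(\Xi)$ is $$d_W(\mathbb{P},\mathbb{P}') = \min_{\Pi\in\mathcal{M}(\Xi\times\Xi)}\Big\{\sum_{\bm{\xi}\in\Xi}\sum_{\bm{\xi}'\in\Xi} d(\bm{\xi},\bm{\xi}')\,\Pi(\bm{\xi},\bm{\xi}') : \Pi \text{ is a coupling of } \mathbb{P} \text{ and } \mathbb{P}'\Big\}.$$ $\delta_{\bm{\xi}}$ is the Dirac distribution at $\bm{\xi}$, and $\mathbb{P}^N$ is the $N$-fold product distribution governing the observations. $|\Xi|$ is the cardinality of $\Xi$. *)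

theory Defs
  imports "HOL-Probability.Probability"
begin

text \<open>
  A norm on a real vector space given as a function. The type class \<open>real_normed_vector\<close> fixes one
  particular norm per type (the Euclidean one on \<open>real ^ 'm\<close>), whereas here the norm is arbitrary.
\<close>

definition is_norm :: "('a::real_vector \<Rightarrow> real) \<Rightarrow> bool" where
  "is_norm \<nu> \<longleftrightarrow>
     (\<forall>x. 0 \<le> \<nu> x) \<and>
     (\<forall>x. \<nu> x = 0 \<longleftrightarrow> x = 0) \<and>
     (\<forall>c x. \<nu> (c *\<^sub>R x) = \<bar>c\<bar> * \<nu> x) \<and>
     (\<forall>x y. \<nu> (x + y) \<le> \<nu> x + \<nu> y)"

definition norm_dist :: "('a::real_vector \<Rightarrow> real) \<Rightarrow> 'a \<Rightarrow> 'a \<Rightarrow> real" where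
  "norm_dist \<nu> x y = \<nu> (x - y)"

text \<open>
  Probability distributions on a finite set \<open>S\<close> are rendered as probability mass functions whose
  support is contained in \<open>S\<close> (and need not be all of \<open>S\<close>).
\<close>

definition distributions_on :: "'a set \<Rightarrow> 'a pmf set" where
  "distributions_on S = {p. set_pmf p \<subseteq> S}"

definition is_coupling :: "('a \<times> 'a) pmf \<Rightarrow> 'a pmf \<Rightarrow> 'a pmf \<Rightarrow> bool" where
  "is_coupling \<gamma> P Q \<longleftrightarrow> map_pmf fst \<gamma> = P \<and> map_pmf snd \<gamma> = Q"

definition transport_cost :: "'a set \<Rightarrow> ('a \<Rightarrow> 'a \<Rightarrow> real) \<Rightarrow> ('a \<times> 'a) pmf \<Rightarrow> real" where
  "transport_cost \<Xi> d \<gamma> = (\<Sum>\<xi>\<in>\<Xi>. \<Sum>\<xi>'\<in>\<Xi>. d \<xi> \<xi>' * pmf \<gamma> (\<xi>, \<xi>'))"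

text \<open>
  The infimum below is a minimum whenever \<open>\<Xi>\<close> is finite and \<open>P\<close>, \<open>Q\<close> are distributions on \<open>\<Xi>\<close>;
  see \<open>wasserstein_attained\<close>.
\<close>

definition wasserstein :: "'a set \<Rightarrow> ('a \<Rightarrow> 'a \<Rightarrow> real) \<Rightarrow> 'a pmf \<Rightarrow> 'a pmf \<Rightarrow> real" where
  "wasserstein \<Xi> d P Q =
     (INF \<gamma> \<in> {\<gamma> \<in> distributions_on (\<Xi> \<times> \<Xi>). is_coupling \<gamma> P Q}. transport_cost \<Xi> d \<gamma>)"

definition diameter_of :: "'a set \<Rightarrow> ('a \<Rightarrow> 'a \<Rightarrow> real) \<Rightarrow> real" where
  "diameter_of \<Xi> d = Max ((\<lambda>(\<xi>, \<xi>'). d \<xi> \<xi>') ` (\<Xi> \<times> \<Xi>))"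

text \<open>
  The sample is indexed by \<open>{..<N}\<close>. The uniform mixture of the Dirac distributions
  \<open>return_pmf (\<omega> i)\<close> is the empirical distribution; see \<open>pmf_empirical\<close>.
\<close>

definition empirical :: "nat \<Rightarrow> (nat \<Rightarrow> 'a) \<Rightarrow> 'a pmf" where
  "empirical N \<omega> = bind_pmf (pmf_of_set {..<N}) (\<lambda>i. return_pmf (\<omega> i))"

text \<open>
  The law of \<open>N\<close> independent observations from \<open>P\<close>, as a distribution on functions; the values
  outside \<open>{..<N}\<close> are irrelevant and fixed to \<open>undefined\<close>.
\<close>

definition sample_pmf :: "nat \<Rightarrow> 'a pmf \<Rightarrow> (nat \<Rightarrow> 'a) pmf" where
  "sample_pmf N P = Pi_pmf {..<N} undefined (\<lambda>_. P)"

lemma pmf_empirical: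
  assumes "N > 0"
  shows "pmf (empirical N \<omega>) x = 1 / real N * (\<Sum>i<N. pmf (return_pmf (\<omega> i)) x)"
  unfolding empirical_def using assms
  by (subst pmf_bind_pmf_of_set) (auto simp: lessThan_empty_iff)

lemma pmf_fst_eq_sum:
  assumes "finite B" "set_pmf \<gamma> \<subseteq> A \<times> B"
  shows "pmf (map_pmf fst \<gamma>) x = (\<Sum>y\<in>B. pmf \<gamma> (x, y))"
proof -
  have "pmf (map_pmf fst \<gamma>) x = measure_pmf.prob \<gamma> (fst -` {x})"
    by (rule pmf_map)
  also have "\<dots> = measure_pmf.prob \<gamma> (Pair x ` B)"
    using assms(2) by (intro measure_pmf.finite_measure_eq_AE) (auto simp: AE_measure_pmf_iff)
  also have "\<dots> = (\<Sum>y\<in>B. pmf \<gamma> (x, y))"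
    using assms(1) by (simp add: measure_measure_pmf_finite sum.reindex inj_on_def)
  finally show ?thesis .
qed

lemma pmf_snd_eq_sum:
  assumes "finite A" "set_pmf \<gamma> \<subseteq> A \<times> B"
  shows "pmf (map_pmf snd \<gamma>) y = (\<Sum>x\<in>A. pmf \<gamma> (x, y))"
proof -
  have "pmf (map_pmf snd \<gamma>) y = measure_pmf.prob \<gamma> (snd -` {y})"
    by (rule pmf_map)
  also have "\<dots> = measure_pmf.prob \<gamma> ((\<lambda>x. (x, y)) ` A)"
    using assms(2) by (intro measure_pmf.finite_measure_eq_AE) (auto simp: AE_measure_pmf_iff)
  also have "\<dots> = (\<Sum>x\<in>A. pmf \<gamma> (x, y))"
    using assms(1) by (simp add: measure_measure_pmf_finite sum.reindex inj_on_def)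
  finally show ?thesis .
qed

lemma wasserstein_attained:
  assumes fin: "finite \<Xi>" and P: "P \<in> distributions_on \<Xi>" and Q: "Q \<in> distributions_on \<Xi>"
  obtains \<gamma> where "\<gamma> \<in> distributions_on (\<Xi> \<times> \<Xi>)" "is_coupling \<gamma> P Q"
    "wasserstein \<Xi> d P Q = transport_cost \<Xi> d \<gamma>"
    "\<And>\<gamma>'. \<gamma>' \<in> distributions_on (\<Xi> \<times> \<Xi>) \<Longrightarrow> is_coupling \<gamma>' P Q \<Longrightarrow>
       transport_cost \<Xi> d \<gamma> \<le> transport_cost \<Xi> d \<gamma>'"
proof -
  define X :: "'a \<times> 'a \<Rightarrow> real set" where "X = (\<lambda>z. if z \<in> \<Xi> \<times> \<Xi> then {0..1} else {0})"
  define K where "K = Pi\<^sub>E UNIV X"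
  define M1 where "M1 = (\<Inter>x\<in>\<Xi>. {f :: 'a \<times> 'a \<Rightarrow> real. (\<Sum>y\<in>\<Xi>. f (x, y)) = pmf P x})"
  define M2 where "M2 = (\<Inter>y\<in>\<Xi>. {f :: 'a \<times> 'a \<Rightarrow> real. (\<Sum>x\<in>\<Xi>. f (x, y)) = pmf Q y})"
  define cost where "cost = (\<lambda>f :: 'a \<times> 'a \<Rightarrow> real. \<Sum>x\<in>\<Xi>. \<Sum>y\<in>\<Xi>. d x y * f (x, y))"
  have "compactin (product_topology (\<lambda>_. euclidean) UNIV) K"
    unfolding K_def X_def by (subst compactin_PiE) auto
  then have compK: "compact K"
    by (simp add: euclidean_product_topology)
  have closed: "closed M1" "closed M2"
    unfolding M1_def M2_def
    by (intro closed_INT ballI closed_Collect_eq continuous_on_sum continuous_on_const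
        continuous_on_product_coordinates)+
  have comp: "compact (K \<inter> (M1 \<inter> M2))"
    using compK closed by (intro compact_Int_closed closed_Int)
  have cont: "continuous_on (K \<inter> (M1 \<inter> M2)) cost"
    unfolding cost_def
    by (intro continuous_on_sum continuous_on_mult continuous_on_const
        continuous_on_subset[OF continuous_on_product_coordinates] subset_UNIV)
  have mem: "pmf \<gamma> \<in> K \<inter> (M1 \<inter> M2)"
    if "\<gamma> \<in> distributions_on (\<Xi> \<times> \<Xi>)" "is_coupling \<gamma> P Q" for \<gamma>
  proof -
    have sub: "set_pmf \<gamma> \<subseteq> \<Xi> \<times> \<Xi>" and m: "map_pmf fst \<gamma> = P" "map_pmf snd \<gamma> = Q"
      using that by (auto simp: distributions_on_def is_coupling_def)
    have "pmf \<gamma> \<in> K"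
      using sub by (auto simp: K_def X_def pmf_le_1 pmf_eq_0_set_pmf)
    moreover have "pmf \<gamma> \<in> M1" "pmf \<gamma> \<in> M2"
      using pmf_fst_eq_sum[OF fin sub] pmf_snd_eq_sum[OF fin sub] m by (auto simp: M1_def M2_def)
    ultimately show ?thesis by auto
  qed
  have "pair_pmf P Q \<in> distributions_on (\<Xi> \<times> \<Xi>)" "is_coupling (pair_pmf P Q) P Q"
    using P Q by (auto simp: distributions_on_def is_coupling_def map_fst_pair_pmf map_snd_pair_pmf)
  from mem[OF this] have "K \<inter> (M1 \<inter> M2) \<noteq> {}" by blast
  from continuous_attains_inf[OF comp this cont] obtain f
    where f: "f \<in> K" "f \<in> M1" "f \<in> M2" and fmin: "\<And>g. g \<in> K \<inter> (M1 \<inter> M2) \<Longrightarrow> cost f \<le> cost g"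
    by blast
  have fX: "f z \<in> X z" for z
    using f(1) by (auto simp: K_def)
  have nonneg: "0 \<le> f z" for z
    using fX[of z] by (auto simp: X_def split: if_splits)
  have zero: "f z = 0" if "z \<notin> \<Xi> \<times> \<Xi>" for z
    using fX[of z] that by (auto simp: X_def split: if_splits)
  have "(\<Sum>z\<in>\<Xi> \<times> \<Xi>. f z) = (\<Sum>x\<in>\<Xi>. \<Sum>y\<in>\<Xi>. f (x, y))"
    by (simp add: sum.cartesian_product)
  also have "\<dots> = (\<Sum>x\<in>\<Xi>. pmf P x)"
    using f(2) by (intro sum.cong) (auto simp: M1_def)
  also have "\<dots> = 1"
    using P fin by (intro sum_pmf_eq_1) (auto simp: distributions_on_def)
  finally have tot: "(\<Sum>z\<in>\<Xi> \<times> \<Xi>. f z) = 1" .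
  have "(\<integral>\<^sup>+z. ennreal (f z) \<partial>count_space UNIV) = (\<Sum>z\<in>\<Xi> \<times> \<Xi>. ennreal (f z))"
    using fin zero by (intro nn_integral_count_space') auto
  also have "\<dots> = 1"
    using tot nonneg by (simp add: sum_ennreal)
  finally have one: "(\<integral>\<^sup>+z. ennreal (f z) \<partial>count_space UNIV) = 1" .
  define \<gamma> where "\<gamma> = embed_pmf f"
  have pmf\<gamma>: "pmf \<gamma> z = f z" for z
    unfolding \<gamma>_def by (rule pmf_embed_pmf[OF nonneg one])
  have sub: "set_pmf \<gamma> \<subseteq> \<Xi> \<times> \<Xi>"
    using zero by (auto simp: set_pmf_eq pmf\<gamma>)
  have "map_pmf fst \<gamma> = P"
  proof (rule pmf_eqI)
    fix x
    show "pmf (map_pmf fst \<gamma>) x = pmf P x"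
    proof (cases "x \<in> \<Xi>")
      case True
      then show ?thesis
        using f(2) by (simp add: pmf_fst_eq_sum[OF fin sub] pmf\<gamma> M1_def)
    next
      case False
      then have "pmf P x = 0"
        using P by (auto simp: distributions_on_def pmf_eq_0_set_pmf)
      then show ?thesis
        using False zero by (simp add: pmf_fst_eq_sum[OF fin sub] pmf\<gamma>)
    qed
  qed
  moreover have "map_pmf snd \<gamma> = Q"
  proof (rule pmf_eqI)
    fix y
    show "pmf (map_pmf snd \<gamma>) y = pmf Q y"
    proof (cases "y \<in> \<Xi>")
      case True
      then show ?thesis
        using f(3) by (simp add: pmf_snd_eq_sum[OF fin sub] pmf\<gamma> M2_def)
    next
      case False
      then have "pmf Q y = 0"
        using Q by (auto simp: distributions_on_def pmf_eq_0_set_pmf)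
      then show ?thesis
        using False zero by (simp add: pmf_snd_eq_sum[OF fin sub] pmf\<gamma>)
    qed
  qed
  ultimately have coup: "is_coupling \<gamma> P Q"
    by (simp add: is_coupling_def)
  have dist: "\<gamma> \<in> distributions_on (\<Xi> \<times> \<Xi>)"
    using sub by (simp add: distributions_on_def)
  have le: "transport_cost \<Xi> d \<gamma> \<le> transport_cost \<Xi> d \<gamma>'"
    if "\<gamma>' \<in> distributions_on (\<Xi> \<times> \<Xi>)" "is_coupling \<gamma>' P Q" for \<gamma>'
    using fmin[OF mem[OF that]] by (simp add: transport_cost_def cost_def pmf\<gamma>)
  have "wasserstein \<Xi> d P Q = transport_cost \<Xi> d \<gamma>"
    unfolding wasserstein_def using dist coup le by (intro cInf_eq_minimum) auto
  from that[OF dist coup this le] show thesis .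
qed

end

theory Submission
  imports Defs
begin

text \<open>
  Write \<open>Q\<close> for the empirical distribution. Moving the excess mass \<open>(P - Q)\<^sup>+\<close> arbitrarily onto the
  deficit \<open>(Q - P)\<^sup>+\<close> shows that the Wasserstein distance is at most the diameter times
  \<open>\<Sum>x. (Q x - P x)\<^sup>+ = Q A - P A\<close>, where \<open>A\<close> is the set of points with \<open>Q x > P x\<close>. For each fixed
  \<open>A \<subseteq> \<Xi>\<close> Hoeffding's inequality for the binomial distribution gives
  \<open>Q A \<ge> P A + t\<close> with probability at most \<open>exp (- 2 N t\<^sup>2)\<close>. A union bound over the
  \<open>2 ^ |\<Xi>| \<le> (N + 1) ^ |\<Xi>|\<close> subsets \<open>A\<close> yields the claim.
\<close>

section \<open>Transport plans and total variation\<close>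

lemma le_diameter_of:
  assumes "finite \<Xi>" "x \<in> \<Xi>" "y \<in> \<Xi>"
  shows "d x y \<le> diameter_of \<Xi> d"
  unfolding diameter_of_def using assms by (intro Max_ge) auto

text \<open>Cut off outside \<Xi> \<times> \<Xi>, \<open>f\<close> becomes the mass function of a
  coupling, whose cost bounds the minimum. This lets a plan be written as a plain formula.\<close>

lemma wasserstein_le_transport_plan:
  assumes fin: "finite \<Xi>" and P: "P \<in> distributions_on \<Xi>" and Q: "Q \<in> distributions_on \<Xi>"
    and nonneg: "\<And>x y. 0 \<le> f x y"
    and row: "\<And>x. x \<in> \<Xi> \<Longrightarrow> (\<Sum>y\<in>\<Xi>. f x y) = pmf P x"
    and col: "\<And>y. y \<in> \<Xi> \<Longrightarrow> (\<Sum>x\<in>\<Xi>. f x y) = pmf Q y"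
  shows "wasserstein \<Xi> d P Q \<le> (\<Sum>x\<in>\<Xi>. \<Sum>y\<in>\<Xi>. d x y * f x y)"
proof -
  define g where "g = (\<lambda>(x, y). if x \<in> \<Xi> \<and> y \<in> \<Xi> then f x y else 0)"
  have g_nonneg: "0 \<le> g z" for z
    using nonneg by (auto simp: g_def split: prod.splits)
  have g_zero: "g z = 0" if "z \<notin> \<Xi> \<times> \<Xi>" for z
    using that by (auto simp: g_def split: prod.splits)
  have g_eq: "g (x, y) = f x y" if "x \<in> \<Xi>" "y \<in> \<Xi>" for x y
    using that by (simp add: g_def)
  have "(\<Sum>z\<in>\<Xi> \<times> \<Xi>. g z) = (\<Sum>x\<in>\<Xi>. \<Sum>y\<in>\<Xi>. g (x, y))"
    by (simp add: sum.cartesian_product)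
  also have "\<dots> = (\<Sum>x\<in>\<Xi>. pmf P x)"
    by (intro sum.cong refl) (simp add: g_eq row[symmetric])
  also have "\<dots> = 1"
    using P fin by (intro sum_pmf_eq_1) (auto simp: distributions_on_def)
  finally have total: "(\<Sum>z\<in>\<Xi> \<times> \<Xi>. g z) = 1" .
  have "(\<integral>\<^sup>+z. ennreal (g z) \<partial>count_space UNIV) = (\<Sum>z\<in>\<Xi> \<times> \<Xi>. ennreal (g z))"
    using fin g_zero by (intro nn_integral_count_space') auto
  also have "\<dots> = 1"
    using total g_nonneg by (simp add: sum_ennreal)
  finally have one: "(\<integral>\<^sup>+z. ennreal (g z) \<partial>count_space UNIV) = 1" .
  define \<gamma> where "\<gamma> = embed_pmf g"
  have pmf_\<gamma>: "pmf \<gamma> z = g z" for z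
    unfolding \<gamma>_def by (rule pmf_embed_pmf[OF g_nonneg one])
  have sub: "set_pmf \<gamma> \<subseteq> \<Xi> \<times> \<Xi>"
    using g_zero by (auto simp: set_pmf_eq pmf_\<gamma>)
  have outside: "pmf R x = 0" if "R \<in> distributions_on \<Xi>" "x \<notin> \<Xi>" for R :: "'a pmf" and x
    using that by (auto simp: distributions_on_def pmf_eq_0_set_pmf)
  have "map_pmf fst \<gamma> = P"
  proof (rule pmf_eqI)
    show "pmf (map_pmf fst \<gamma>) x = pmf P x" for x
      by (cases "x \<in> \<Xi>")
        (simp_all add: pmf_fst_eq_sum[OF fin sub] pmf_\<gamma> g_eq row g_zero outside[OF P])
  qed
  moreover have "map_pmf snd \<gamma> = Q"
  proof (rule pmf_eqI)
    show "pmf (map_pmf snd \<gamma>) y = pmf Q y" for y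
      by (cases "y \<in> \<Xi>")
        (simp_all add: pmf_snd_eq_sum[OF fin sub] pmf_\<gamma> g_eq col g_zero outside[OF Q])
  qed
  ultimately have coupling: "is_coupling \<gamma> P Q"
    by (simp add: is_coupling_def)
  \<comment> \<open>\<open>d\<close> may take any real values here; comparing with the attained
    minimum avoids a separate proof that the costs are bounded below.\<close>
  have "wasserstein \<Xi> d P Q \<le> transport_cost \<Xi> d \<gamma>"
    using sub coupling wasserstein_attained[OF fin P Q, of d]
    by (metis (no_types, lifting) distributions_on_def mem_Collect_eq)
  also have "\<dots> = (\<Sum>x\<in>\<Xi>. \<Sum>y\<in>\<Xi>. d x y * f x y)"
    unfolding transport_cost_def by (intro sum.cong refl) (simp add: pmf_\<gamma> g_eq)
  finally show ?thesis .
qed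

text \<open>The plan leaves the common mass \<open>min (pmf P x) (pmf Q x)\<close> in place at no
  cost and spreads the excess over the deficit as a rescaled product measure. The sum on the right
  is the total variation distance.\<close>

lemma wasserstein_le_diameter_times_tv:
  assumes fin: "finite \<Xi>" and P: "P \<in> distributions_on \<Xi>" and Q: "Q \<in> distributions_on \<Xi>"
    and refl: "\<And>x. x \<in> \<Xi> \<Longrightarrow> d x x = 0"
  shows "wasserstein \<Xi> d P Q \<le> diameter_of \<Xi> d * (\<Sum>x\<in>\<Xi>. max 0 (pmf Q x - pmf P x))"
proof -
  define a where "a = (\<lambda>x. max 0 (pmf P x - pmf Q x))"
  define b where "b = (\<lambda>x. max 0 (pmf Q x - pmf P x))"
  define \<delta> where "\<delta> = (\<Sum>x\<in>\<Xi>. b x)"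
  have nn: "0 \<le> a x" "0 \<le> b x" for x
    by (auto simp: a_def b_def)
  then have \<delta>_nonneg: "0 \<le> \<delta>"
    by (simp add: \<delta>_def sum_nonneg)
  \<comment> \<open>Excess and deficit have equal totals because \<open>P\<close> and
    \<open>Q\<close> both have mass 1.\<close>
  have "(\<Sum>x\<in>\<Xi>. a x) - (\<Sum>x\<in>\<Xi>. b x) = (\<Sum>x\<in>\<Xi>. pmf P x) - (\<Sum>x\<in>\<Xi>. pmf Q x)"
    unfolding sum_subtractf[symmetric] by (intro sum.cong) (auto simp: a_def b_def)
  also have "\<dots> = 0"
    using fin P Q by (simp add: distributions_on_def sum_pmf_eq_1)
  finally have sum_a: "(\<Sum>x\<in>\<Xi>. a x) = \<delta>"
    by (simp add: \<delta>_def)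
  \<comment> \<open>Needed to cancel \<delta> in the marginals of \<open>f\<close> when \<delta> is
    0.\<close>
  have zero: "a x = 0 \<and> b x = 0" if "\<delta> = 0" "x \<in> \<Xi>" for x
    using that fin nn sum_a \<delta>_def by (simp add: sum_nonneg_eq_0_iff)
  define f where "f = (\<lambda>x y. (if x = y then min (pmf P x) (pmf Q x) else 0) + a x * b y / \<delta>)"
    \<comment> \<open>if \<open>\<delta> = 0\<close> then \<open>P = Q\<close>, and the quotient is the junk value \<open>0\<close>, as desired\<close>
  have row: "(\<Sum>y\<in>\<Xi>. f x y) = pmf P x" if "x \<in> \<Xi>" for x
  proof -
    have "(\<Sum>y\<in>\<Xi>. f x y) = min (pmf P x) (pmf Q x) + a x * \<delta> / \<delta>"
      using fin that
      by (simp add: f_def sum.distrib sum_divide_distrib[symmetric] sum_distrib_left[symmetric] \<delta>_def)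
    also have "\<dots> = min (pmf P x) (pmf Q x) + a x"
      using zero[OF _ that] by (cases "\<delta> = 0") auto
    finally show ?thesis by (auto simp: a_def)
  qed
  have col: "(\<Sum>x\<in>\<Xi>. f x y) = pmf Q y" if "y \<in> \<Xi>" for y
  proof -
    have "(\<Sum>x\<in>\<Xi>. f x y) = min (pmf P y) (pmf Q y) + \<delta> * b y / \<delta>"
      using fin that
      by (simp add: f_def sum.distrib sum_divide_distrib[symmetric] sum_distrib_right[symmetric] sum_a)
    also have "\<dots> = min (pmf P y) (pmf Q y) + b y"
      using zero[OF _ that] by (cases "\<delta> = 0") auto
    finally show ?thesis by (auto simp: b_def)
  qed
  have "wasserstein \<Xi> d P Q \<le> (\<Sum>x\<in>\<Xi>. \<Sum>y\<in>\<Xi>. d x y * f x y)"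
    using nn \<delta>_nonneg by (intro wasserstein_le_transport_plan fin P Q row col) (auto simp: f_def)
  also have "\<dots> = (\<Sum>x\<in>\<Xi>. \<Sum>y\<in>\<Xi>. d x y * (a x * b y / \<delta>))"
    using refl by (intro sum.cong HOL.refl) (auto simp: f_def)
  also have "\<dots> \<le> (\<Sum>x\<in>\<Xi>. \<Sum>y\<in>\<Xi>. diameter_of \<Xi> d * (a x * b y / \<delta>))"
    using fin nn \<delta>_nonneg by (intro sum_mono mult_right_mono le_diameter_of) auto
  \<comment> \<open>The moved mass factors as \<open>\<delta> * \<delta> / \<delta>\<close>, which
    is \<delta> even when \<delta> is 0.\<close>
  also have "\<dots> = diameter_of \<Xi> d * ((\<Sum>x\<in>\<Xi>. a x) * (\<Sum>y\<in>\<Xi>. b y) / \<delta>)"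
    unfolding sum_product by (simp add: sum_distrib_left sum_divide_distrib)
  also have "\<dots> = diameter_of \<Xi> d * \<delta>"
    by (simp add: sum_a \<delta>_def[symmetric])
  finally show ?thesis by (simp add: \<delta>_def b_def)
qed

section \<open>Concentration on a fixed set\<close>

lemma map_pmf_mem_eq_bernoulli:
  "map_pmf (\<lambda>x. x \<in> A) P = bernoulli_pmf (measure_pmf.prob P A)"
proof (rule pmf_eqI)
  fix b
  have "pmf (map_pmf (\<lambda>x. x \<in> A) P) True = measure_pmf.prob P A"
    by (simp add: pmf_map vimage_def)
  moreover have "pmf (map_pmf (\<lambda>x. x \<in> A) P) False = 1 - measure_pmf.prob P A"
    by (simp add: pmf_map vimage_def measure_pmf.prob_compl[symmetric] Compl_eq_Diff_UNIV[symmetric]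
        Compl_eq)
  ultimately show "pmf (map_pmf (\<lambda>x. x \<in> A) P) b = pmf (bernoulli_pmf (measure_pmf.prob P A)) b"
    by (cases b) auto
qed

lemma measure_empirical:
  assumes "N > 0"
  shows "measure_pmf.prob (empirical N \<omega>) A = real (card {i\<in>{..<N}. \<omega> i \<in> A}) / real N"
proof -
  have "empirical N \<omega> = map_pmf \<omega> (pmf_of_set {..<N})"
    by (simp add: empirical_def map_pmf_def)
  then have "measure_pmf.prob (empirical N \<omega>) A = measure_pmf.prob (pmf_of_set {..<N}) (\<omega> -` A)"
    by simp
  also have "\<dots> = real (card ({..<N} \<inter> \<omega> -` A)) / real N"
    using assms by (subst measure_pmf_of_set) (auto simp: lessThan_empty_iff)
  also have "{..<N} \<inter> \<omega> -` A = {i\<in>{..<N}. \<omega> i \<in> A}"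
    by auto
  finally show ?thesis .
qed

lemma map_pmf_card_sample:
  "map_pmf (\<lambda>\<omega>. card {i\<in>{..<N}. \<omega> i \<in> A}) (sample_pmf N P) =
     binomial_pmf N (measure_pmf.prob P A)"
proof -
  \<comment> \<open>The default \<open>undefined \<in> A\<close> is the image of the sample's
    default \<open>undefined\<close> under membership in \<open>A\<close>, as
    \<open>Pi_pmf_map\<close> demands.\<close>
  have "binomial_pmf N (measure_pmf.prob P A) =
    map_pmf (\<lambda>f. card {i\<in>{..<N}. f i})
      (Pi_pmf {..<N} (undefined \<in> A) (\<lambda>_. map_pmf (\<lambda>x. x \<in> A) P))"
    unfolding map_pmf_mem_eq_bernoulli by (rule binomial_pmf_altdef') auto
  also have "\<dots> = map_pmf (\<lambda>\<omega>. card {i\<in>{..<N}. \<omega> i \<in> A}) (sample_pmf N P)"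
    by (subst Pi_pmf_map[where dflt = undefined]) (auto simp: map_pmf_comp sample_pmf_def)
  finally show ?thesis ..
qed

text \<open>For a set \<open>A\<close> chosen before sampling, the number of hits is binomial, so
  Hoeffding's bound \<open>prob_ge'\<close> applies.\<close>

lemma prob_empirical_ge:
  assumes N: "N > 0" and t: "t \<ge> 0"
  shows "measure_pmf.prob (sample_pmf N P)
           {\<omega>. measure_pmf.prob (empirical N \<omega>) A \<ge> measure_pmf.prob P A + t}
         \<le> exp (- 2 * real N * t\<^sup>2)"
proof -
  define p where "p = measure_pmf.prob P A"
  interpret binomial_distribution N p
    by unfold_locales (auto simp: p_def)
  have "{\<omega>. measure_pmf.prob (empirical N \<omega>) A \<ge> p + t} =
      (\<lambda>\<omega>. card {i\<in>{..<N}. \<omega> i \<in> A}) -` {k. real k / real N \<ge> p + t}"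
    using N by (auto simp: measure_empirical)
  then have "measure_pmf.prob (sample_pmf N P) {\<omega>. measure_pmf.prob (empirical N \<omega>) A \<ge> p + t} =
      measure_pmf.prob (binomial_pmf N p) {k. real k / real N \<ge> p + t}"
    by (simp add: p_def map_pmf_card_sample[symmetric])
  also have "\<dots> \<le> exp (- 2 * real N * t\<^sup>2)"
    using prob_ge'[OF N t] by simp
  finally show ?thesis by (simp add: p_def)
qed

section \<open>Union bound over subsets\<close>

lemma sum_max_eq_measure_diff:
  fixes P Q :: "'a pmf"
  assumes "finite \<Xi>"
  defines "A \<equiv> {x \<in> \<Xi>. pmf P x < pmf Q x}"
  shows "(\<Sum>x\<in>\<Xi>. max 0 (pmf Q x - pmf P x)) = measure_pmf.prob Q A - measure_pmf.prob P A"
proof -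
  have "(\<Sum>x\<in>\<Xi>. max 0 (pmf Q x - pmf P x)) = (\<Sum>x\<in>A. pmf Q x - pmf P x)"
    using assms(1) by (intro sum.mono_neutral_cong_right) (auto simp: A_def)
  also have "\<dots> = measure_pmf.prob Q A - measure_pmf.prob P A"
    using assms(1) by (simp add: A_def sum_subtractf measure_measure_pmf_finite)
  finally show ?thesis .
qed

lemma set_pmf_empirical_subset:
  assumes "N > 0" "\<omega> \<in> set_pmf (sample_pmf N P)"
  shows "set_pmf (empirical N \<omega>) \<subseteq> set_pmf P"
  using assms by (auto simp: empirical_def sample_pmf_def set_Pi_pmf PiE_dflt_def lessThan_empty_iff)

text \<open>The set where the empirical distribution exceeds \<open>P\<close> depends on the sample,
  hence the union over all subsets of \<Xi>.\<close>

lemma prob_wasserstein_empirical_gt: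
  assumes fin: "finite \<Xi>" and P: "P \<in> distributions_on \<Xi>" and N: "N > 0" and t: "t \<ge> 0"
    and refl: "\<And>x. x \<in> \<Xi> \<Longrightarrow> d x x = 0"
  shows "measure_pmf.prob (sample_pmf N P)
           {\<omega>. wasserstein \<Xi> d P (empirical N \<omega>) > diameter_of \<Xi> d * t}
         \<le> 2 ^ card \<Xi> * exp (- 2 * real N * t\<^sup>2)"
proof -
  define E where "E = (\<lambda>A. {\<omega>. measure_pmf.prob (empirical N \<omega>) A \<ge> measure_pmf.prob P A + t})"
  \<comment> \<open>A distribution has nonempty support, so the maximum defining the diameter is
    over a nonempty set.\<close>
  obtain x where "x \<in> \<Xi>"
    using P set_pmf_not_empty[of P] by (auto simp: distributions_on_def)
  then have diam: "0 \<le> diameter_of \<Xi> d"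
    using le_diameter_of[OF fin, of x x d] refl by simp
  \<comment> \<open>Only samples in the support are sure to have their empirical distribution on
    \<Xi>; the others are discarded below by almost-everywhere monotonicity.\<close>
  have "\<omega> \<in> (\<Union>A\<in>Pow \<Xi>. E A)"
    if \<omega>: "\<omega> \<in> set_pmf (sample_pmf N P)"
      and large: "wasserstein \<Xi> d P (empirical N \<omega>) > diameter_of \<Xi> d * t" for \<omega>
  proof -
    let ?Q = "empirical N \<omega>"
    define A where "A = {x \<in> \<Xi>. pmf P x < pmf ?Q x}"
    have "?Q \<in> distributions_on \<Xi>"
      using set_pmf_empirical_subset[OF N \<omega>] P by (auto simp: distributions_on_def)
    from wasserstein_le_diameter_times_tv[where d = d, OF fin P this refl] large
    have "diameter_of \<Xi> d * t
        < diameter_of \<Xi> d * (measure_pmf.prob ?Q A - measure_pmf.prob P A)"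
      using sum_max_eq_measure_diff[OF fin, of ?Q P] by (simp add: A_def)
    \<comment> \<open>Strictness permits cancelling the diameter: if it were 0, the previous
      inequality would read 0 < 0.\<close>
    then have "t < measure_pmf.prob ?Q A - measure_pmf.prob P A"
      using diam by (rule mult_left_less_imp_less)
    then show ?thesis
      by (intro UN_I[of A]) (auto simp: E_def A_def)
  qed
  then have "measure_pmf.prob (sample_pmf N P)
      {\<omega>. wasserstein \<Xi> d P (empirical N \<omega>) > diameter_of \<Xi> d * t}
    \<le> measure_pmf.prob (sample_pmf N P) (\<Union>A\<in>Pow \<Xi>. E A)"
    by (intro measure_pmf.finite_measure_mono_AE) (auto simp: AE_measure_pmf_iff)
  also have "\<dots> \<le> (\<Sum>A\<in>Pow \<Xi>. measure_pmf.prob (sample_pmf N P) (E A))"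
    using fin by (intro measure_pmf.finite_measure_subadditive_finite) auto
  also have "\<dots> \<le> (\<Sum>A\<in>Pow \<Xi>. exp (- 2 * real N * t\<^sup>2))"
    unfolding E_def by (intro sum_mono prob_empirical_ge N t)
  also have "\<dots> = 2 ^ card \<Xi> * exp (- 2 * real N * t\<^sup>2)"
    using fin by (simp add: card_Pow)
  finally show ?thesis .
qed

theorem theorem1:
  fixes \<nu> :: "real ^ 'm \<Rightarrow> real"
    and \<Xi> :: "(real ^ 'm) set"
    and P :: "(real ^ 'm) pmf"
    and N :: nat
    and \<beta> \<epsilon> :: real
  assumes "is_norm \<nu>"
    and "finite \<Xi>"
    and "\<Xi> \<subseteq> {\<xi>. \<forall>i. \<xi> $ i \<in> {0, 1}}"
    and "P \<in> distributions_on \<Xi>"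
    and "N > 0"
    and "0 < \<beta>" and "\<beta> < 1"
    and "\<epsilon> \<ge> diameter_of \<Xi> (norm_dist \<nu>) *
           sqrt ((real (card \<Xi>) * ln (real N + 1) + ln (1 / \<beta>)) / (2 * real N))"
  shows "measure_pmf.prob (sample_pmf N P)
           {\<omega>. wasserstein \<Xi> (norm_dist \<nu>) P (empirical N \<omega>) \<le> \<epsilon>} \<ge> 1 - \<beta>"
proof -
  define L where "L = real (card \<Xi>) * ln (real N + 1) + ln (1 / \<beta>)"
  \<comment> \<open>Chosen so that the Hoeffding factor is \<open>exp (- L)\<close>, which equals
    \<beta> divided by \<open>(real N + 1) ^ card \<Xi>\<close>.\<close>
  define t where "t = sqrt (L / (2 * real N))"
  let ?W = "\<lambda>\<omega>. wasserstein \<Xi> (norm_dist \<nu>) P (empirical N \<omega>)"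
  let ?prob = "measure_pmf.prob (sample_pmf N P)"
  have N: "real N > 0"
    using \<open>N > 0\<close> by simp
  have "L \<ge> 0"
    using \<open>0 < \<beta>\<close> \<open>\<beta> < 1\<close> by (simp add: L_def)
  then have t: "t \<ge> 0" "2 * real N * t\<^sup>2 = L"
    using N by (simp_all add: t_def)
  have refl: "norm_dist \<nu> x x = 0" for x
    using \<open>is_norm \<nu>\<close> by (simp add: is_norm_def norm_dist_def)
  \<comment> \<open>\<open>N > 0\<close> gives 2 \<le> \<open>real N + 1\<close>, so the number of
    subsets is absorbed by that power.\<close>
  have "(2::real) ^ card \<Xi> * exp (- L) \<le> (real N + 1) ^ card \<Xi> * exp (- L)"
    using \<open>N > 0\<close> by (intro mult_right_mono power_mono) auto
  also have "\<dots> = \<beta>"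
    using N \<open>0 < \<beta>\<close> by (simp add: L_def exp_add exp_minus exp_of_nat_mult ln_div exp_diff)
  finally have count: "(2::real) ^ card \<Xi> * exp (- L) \<le> \<beta>" .
  have "1 - ?prob {\<omega>. ?W \<omega> \<le> \<epsilon>} = ?prob (- {\<omega>. ?W \<omega> \<le> \<epsilon>})"
    using measure_pmf.prob_compl[of "{\<omega>. ?W \<omega> \<le> \<epsilon>}" "sample_pmf N P"]
    by (simp add: Compl_eq_Diff_UNIV)
  also have "\<dots> \<le> ?prob {\<omega>. ?W \<omega> > diameter_of \<Xi> (norm_dist \<nu>) * t}"
    using assms(8) by (intro measure_pmf.finite_measure_mono) (auto simp: t_def L_def)
  also have "\<dots> \<le> 2 ^ card \<Xi> * exp (- 2 * real N * t\<^sup>2)"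
    by (rule prob_wasserstein_empirical_gt) (use assms t refl in auto)
  also have "\<dots> \<le> \<beta>"
    using count t(2) by simp
  finally show ?thesis by simp
qed

end
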